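(* Let $(X,d)$ be a complete metric space. Let $\mathcal{F}=\{F_i : i\in\mathbb{N}\}$ be a countable family of contraction maps on $X$ and let $\rho=\{\rho_i : i\in\mathbb{N}\}$ be a probability sequence, i.e. $0<\rho_i<1$ and $\sum_{i=1}^\infty\rho_i=1$. If $\mu$ is an invariant measure for $(\mathcal{F},\rho)$, then $\mathrm{supp}\,\mu=\overline{P}$, where $P$ is the set of fixed points of finite compositions of members of $\mathcal{F}$.
   Context: A map $F:X\to X$ is a contraction if there is a constant $c$ with $0<c<1$ such that $d(F(x),F(y))\le c\,d(x,y)$ for all $x,y\in X$. $P$ is the set of all points $x\in X$ such that $F_{i_1}\circ\dots\circ F_{i_k}(x)=x$ for some $k\ge 1$ and some $i_1,\dots,i_k\in\mathbb{N}$. An invariant measure for $(\mathcal{F},\rho)$ is a Borel probability measure $\mu$ on $X$ such that $\mu(E)=\sum_{i=1}^\infty\rho_i\,\mu(F_i^{-1}(E))$ for every Borel set $E\subset X$. The support $\mathrm{supp}\,\mu$ is the set of all $x\in X$ such that $\mu(B(x,\varepsilon))>0$ for every $\varepsilon>0$, where $B(x,\varepsilon)$ is the open ball. *)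

theory Defs
  imports "HOL-Probability.Probability"
begin

definition contraction :: "('a::metric_space \<Rightarrow> 'a) \<Rightarrow> bool" where
  "contraction F \<longleftrightarrow> (\<exists>c. 0 < c \<and> c < 1 \<and> (\<forall>x y. dist (F x) (F y) \<le> c * dist x y))"

(* Countable families and sequences are indexed by nat starting at 0. *)

definition probability_sequence :: "(nat \<Rightarrow> real) \<Rightarrow> bool" where
  "probability_sequence \<rho> \<longleftrightarrow> (\<forall>i. 0 < \<rho> i \<and> \<rho> i < 1) \<and> \<rho> sums 1"

(* compose_word F [i1, ..., ik] = F i1 \<circ> ... \<circ> F ik *)
definition compose_word :: "(nat \<Rightarrow> 'a \<Rightarrow> 'a) \<Rightarrow> nat list \<Rightarrow> 'a \<Rightarrow> 'a" where
  "compose_word F w = foldr (\<lambda>i g. F i \<circ> g) w id"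

definition fixed_points_of_compositions :: "(nat \<Rightarrow> 'a \<Rightarrow> 'a) \<Rightarrow> 'a set" where
  "fixed_points_of_compositions F = {x. \<exists>w. w \<noteq> [] \<and> compose_word F w x = x}"

definition invariant_measure ::
    "(nat \<Rightarrow> 'a::topological_space \<Rightarrow> 'a) \<Rightarrow> (nat \<Rightarrow> real) \<Rightarrow> 'a measure \<Rightarrow> bool" where
  "invariant_measure F \<rho> \<mu> \<longleftrightarrow>
     prob_space \<mu> \<and> sets \<mu> = sets borel \<and>
     (\<forall>E\<in>sets borel. (\<lambda>i. \<rho> i * measure \<mu> (F i -` E)) sums measure \<mu> E)"

definition measure_support :: "'a::metric_space measure \<Rightarrow> 'a set" where
  "measure_support \<mu> = {x. \<forall>\<epsilon>>0. measure \<mu> (ball x \<epsilon>) > 0}"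

end

theory Submission
  imports Defs
begin

text \<open>
  Write \<open>F\<^sub>w\<close> for the composition along a word \<open>w\<close>. Both inclusions are obtained by pulling
  sets back along words; invariance says that the mass of \<open>E\<close> is the average of the masses of
  the sets \<open>F\<^sub>i\<^sup>-\<^sup>1(E)\<close>.

  If \<open>x\<close> is fixed by \<open>F\<^sub>w\<close> and \<open>F\<^sub>w\<close> has ratio \<open>c < 1\<close>, the preimage under \<open>F\<^sub>w\<close> of the ball of
  radius \<open>r\<close> about \<open>x\<close> contains the ball of radius \<open>r / c\<close>. Repeated pulling back blows every
  ball about \<open>x\<close> up to one of positive mass, and positivity of the mass of a preimage passes
  to the set itself because all weights are positive. So \<open>x\<close> is in the support, which is a
  closed set.

  Conversely, let \<open>E\<close> be a small ball about a point \<open>x\<close> of the support. The contraction ratios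
  of the \<open>F\<^sub>i\<close> may tend to 1, so a long word need not contract strongly; but a word that
  contains the letter 0 at least \<open>k\<close> times has ratio at most \<open>c\<^sup>k\<close>, where \<open>c\<close> is a ratio of
  \<open>F\<^sub>0\<close>. Almost every infinite word contains the letter 0 infinitely often, which suggests that
  the mass of \<open>E\<close> is controlled by the masses of the \<open>F\<^sub>v\<^sup>-\<^sup>1(E)\<close> with \<open>v\<close> of this kind alone; this
  is \<open>ex_word_frequent_letter\<close>, and a supremum argument proves it without a measure on
  infinite words. Consequently some such preimage meets a fixed large ball about \<open>x\<close>, that is,
  a strongly contracting \<open>F\<^sub>v\<close> maps a point at bounded distance from \<open>x\<close> into \<open>E\<close>. The fixed
  point of \<open>F\<^sub>v\<close>, given by Banach's theorem, is then close to \<open>x\<close>.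

  The space need not be separable, so \<open>\<mu>\<close> might have mass outside its support; the argument
  works only with masses of balls and never with the mass of the support.
\<close>

section \<open>Compositions of contractions\<close>

lemma compose_word_Nil [simp]: "compose_word F [] = id"
  by (simp add: compose_word_def)

lemma compose_word_Cons [simp]: "compose_word F (i # w) = F i \<circ> compose_word F w"
  by (simp add: compose_word_def)

lemma compose_word_append:
  "compose_word F (v @ w) = compose_word F v \<circ> compose_word F w"
  by (induction v) (auto simp: comp_assoc)

lemma contraction_ratio:
  assumes "contraction f"
  obtains c where "0 < c" "c < 1" "c-lipschitz_on UNIV f"
  using assms by (force simp: contraction_def lipschitz_on_def)

lemma contraction_nonexpansive: "contraction f \<Longrightarrow> 1-lipschitz_on UNIV f"
  by (meson contraction_ratio less_imp_le lipschitz_on_le)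

text \<open>Occurrences of a single letter already bound the ratio: the other factors have ratio at
  most 1, and no uniform bound below 1 for them is available.\<close>

lemma compose_word_lipschitz:
  assumes nonexp: "\<And>i. 1-lipschitz_on UNIV (F i)"
    and c: "c-lipschitz_on UNIV (F j)"
  shows "(c ^ count_list w j)-lipschitz_on UNIV (compose_word F w)"
proof (induction w)
  case Nil
  show ?case by (auto simp: lipschitz_on_def)
next
  case (Cons i w)
  let ?d = "if i = j then c else 1"
  have "?d-lipschitz_on (range (compose_word F w)) (F i)"
    by (rule lipschitz_on_subset[of _ UNIV]) (auto simp: nonexp c)
  from lipschitz_on_compose[OF Cons.IH this] show ?case
    by (cases "i = j") auto
qed

lemma borel_vimage_compose_word:
  fixes F :: "nat \<Rightarrow> 'a::metric_space \<Rightarrow> 'a"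
  assumes "\<And>i. contraction (F i)" and "E \<in> sets borel"
  shows "compose_word F w -` E \<in> sets borel"
proof -
  have "(1 ^ count_list w 0)-lipschitz_on UNIV (compose_word F w)"
    by (intro compose_word_lipschitz contraction_nonexpansive assms(1))
  then have "continuous_on UNIV (compose_word F w)"
    by (rule lipschitz_on_continuous_on)
  then have "compose_word F w \<in> borel_measurable borel"
    by (rule borel_measurable_continuous_onI)
  from measurable_sets[OF this assms(2)] show ?thesis by simp
qed

lemma fixed_point_near_almost_fixed_point:
  fixes f :: "'a::complete_space \<Rightarrow> 'a"
  assumes "C-lipschitz_on UNIV f" and "C < 1"
  obtains p where "f p = p" "(1 - C) * dist p y \<le> dist (f y) y"
proof -
  have C: "0 \<le> C" and f: "dist (f u) (f v) \<le> C * dist u v" for u v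
    using assms(1) by (auto simp: lipschitz_on_def)
  obtain p where p: "f p = p"
    using banach_fix_type[OF C assms(2)] f by metis
  have "dist p y \<le> dist (f p) (f y) + dist (f y) y"
    unfolding p by (rule dist_triangle)
  also have "\<dots> \<le> C * dist p y + dist (f y) y"
    using f by simp
  finally have "(1 - C) * dist p y \<le> dist (f y) y"
    by (simp add: algebra_simps)
  with p show thesis by (rule that)
qed

section \<open>Borel probability measures on metric spaces\<close>

lemma ex_ball_measure_gt:
  fixes \<mu> :: "'a::metric_space measure"
  assumes "prob_space \<mu>" and "sets \<mu> = sets borel" and "a < 1"
  obtains R where "0 < R" "a < measure \<mu> (ball x R)"
proof -
  interpret prob_space \<mu> by fact
  have "(\<Union>n. ball x (real n)) = UNIV"
    using reals_Archimedean2 by auto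
  moreover have "(\<lambda>n. measure \<mu> (ball x (real n))) \<longlonglongrightarrow> measure \<mu> (\<Union>n. ball x (real n))"
    by (rule finite_Lim_measure_incseq) (auto simp: assms(2) incseq_def)
  moreover have "measure \<mu> UNIV = 1"
    using prob_space sets_eq_imp_space_eq[OF assms(2)] by simp
  ultimately have "(\<lambda>n. measure \<mu> (ball x (real n))) \<longlonglongrightarrow> 1"
    by simp
  then have "eventually (\<lambda>n. a < measure \<mu> (ball x (real n))) sequentially"
    using assms(3) by (rule order_tendstoD)
  moreover have "eventually (\<lambda>n. 0 < n) sequentially"
    by (rule eventually_gt_at_top)
  ultimately have "eventually (\<lambda>n. 0 < n \<and> a < measure \<mu> (ball x (real n))) sequentially"
    by eventually_elim simp
  then obtain n where "0 < n" "a < measure \<mu> (ball x (real n))"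
    by (auto simp: eventually_sequentially)
  then show thesis using that[of "real n"] by simp
qed

lemma closed_measure_support:
  fixes \<mu> :: "'a::metric_space measure"
  assumes "finite_measure \<mu>" and "sets \<mu> = sets borel"
  shows "closed (measure_support \<mu>)"
proof -
  interpret finite_measure \<mu> by fact
  have "x \<in> measure_support \<mu>" if x: "x \<in> closure (measure_support \<mu>)" for x
    unfolding measure_support_def
  proof (intro CollectI allI impI)
    fix e :: real
    assume "0 < e"
    then obtain y where y: "y \<in> measure_support \<mu>" "dist y x < e / 2"
      using x unfolding closure_approachable by (meson half_gt_zero)
    have "ball y (e / 2) \<subseteq> ball x e"
    proof
      fix z assume "z \<in> ball y (e / 2)"
      then show "z \<in> ball x e"
        using y(2) dist_triangle[of x z y] by (simp add: dist_commute)
    qed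
    then have "measure \<mu> (ball y (e / 2)) \<le> measure \<mu> (ball x e)"
      by (rule finite_measure_mono) (simp add: assms(2))
    moreover have "0 < measure \<mu> (ball y (e / 2))"
      using y(1) \<open>0 < e\<close> by (simp add: measure_support_def)
    ultimately show "0 < measure \<mu> (ball x e)" by simp
  qed
  then show ?thesis
    using closure_subset_eq by blast
qed

section \<open>Fixed points lie in the support\<close>

lemma measure_pos_if_vimage_word_pos:
  fixes F :: "nat \<Rightarrow> 'a::metric_space \<Rightarrow> 'a"
  assumes F: "\<And>i. contraction (F i)"
    and \<rho>: "probability_sequence \<rho>"
    and \<mu>: "invariant_measure F \<rho> \<mu>"
    and "E \<in> sets borel" and "0 < measure \<mu> (compose_word F w -` E)"
  shows "0 < measure \<mu> E"
  using assms(4,5)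
proof (induction w arbitrary: E)
  case Nil
  then show ?case by simp
next
  case (Cons i w)
  have "F i -` E \<in> sets borel"
    using borel_vimage_compose_word[OF F Cons.prems(1), where w = "[i]"] by simp
  then have pos: "0 < \<rho> i * measure \<mu> (F i -` E)"
    using Cons.IH[of "F i -` E"] Cons.prems(2) \<rho>
    by (simp add: vimage_comp probability_sequence_def comp_def)
  have sums: "(\<lambda>i. \<rho> i * measure \<mu> (F i -` E)) sums measure \<mu> E"
    using \<mu> Cons.prems(1) by (simp add: invariant_measure_def)
  have "\<And>j. 0 \<le> \<rho> j * measure \<mu> (F j -` E)"
    using \<rho> by (simp add: probability_sequence_def less_imp_le)
  then have "0 < (\<Sum>j. \<rho> j * measure \<mu> (F j -` E))"
    by (intro suminf_pos2[of _ i] pos sums_summable[OF sums])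
  then show ?case
    using sums_unique[OF sums] by simp
qed

lemma fixed_points_subset_measure_support:
  fixes F :: "nat \<Rightarrow> 'a::metric_space \<Rightarrow> 'a"
  assumes F: "\<And>i. contraction (F i)"
    and \<rho>: "probability_sequence \<rho>"
    and \<mu>: "invariant_measure F \<rho> \<mu>"
  shows "fixed_points_of_compositions F \<subseteq> measure_support \<mu>"
proof
  interpret prob_space \<mu>
    using \<mu> by (simp add: invariant_measure_def)
  have sets: "sets \<mu> = sets borel"
    using \<mu> by (simp add: invariant_measure_def)
  fix x
  assume "x \<in> fixed_points_of_compositions F"
  then obtain w where w: "w \<noteq> []" "compose_word F w x = x"
    by (auto simp: fixed_points_of_compositions_def)
  obtain c0 where c0: "0 < c0" "c0 < 1" "c0-lipschitz_on UNIV (F (hd w))"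
    using contraction_ratio[OF F] .
  define c where "c = c0 ^ count_list w (hd w)"
  have "count_list w (hd w) \<noteq> 0"
    using w(1) by (simp add: count_list_0_iff)
  then have c: "0 < c" "c < 1"
    using c0 by (auto simp: c_def power_less_one_iff)
  have lip: "c-lipschitz_on UNIV (compose_word F w)"
    unfolding c_def by (intro compose_word_lipschitz contraction_nonexpansive F c0(3))
  have enlarge: "0 < measure \<mu> (ball x r)" if "0 < measure \<mu> (ball x (r / c))" for r
  proof -
    have "ball x (r / c) \<subseteq> compose_word F w -` ball x r"
    proof
      fix y assume "y \<in> ball x (r / c)"
      then have "c * dist x y < r"
        using c by (simp add: field_simps)
      moreover have "dist x (compose_word F w y) \<le> c * dist x y"
        using lipschitz_onD[OF lip, of x y] w(2) by simp
      ultimately show "y \<in> compose_word F w -` ball x r" by simp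
    qed
    then have "measure \<mu> (ball x (r / c)) \<le> measure \<mu> (compose_word F w -` ball x r)"
      by (rule finite_measure_mono) (simp add: sets borel_vimage_compose_word[OF F])
    with that have "0 < measure \<mu> (compose_word F w -` ball x r)" by simp
    then show ?thesis
      by (rule measure_pos_if_vimage_word_pos[OF F \<rho> \<mu>, rotated]) simp
  qed
  have iterate: "0 < measure \<mu> (ball x (r / c ^ n)) \<Longrightarrow> 0 < measure \<mu> (ball x r)" for r n
  proof (induction n arbitrary: r)
    case 0
    then show ?case by simp
  next
    case (Suc n)
    then have "0 < measure \<mu> (ball x (r / c / c ^ n))" by simp
    then show ?case
      by (intro enlarge[of r] Suc.IH[of "r / c"])
  qed
  show "x \<in> measure_support \<mu>"
    unfolding measure_support_def
  proof (intro CollectI allI impI)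
    fix r :: real
    assume r: "0 < r"
    obtain R where R: "0 < R" "0 < measure \<mu> (ball x R)"
      using ex_ball_measure_gt[OF prob_space_axioms sets zero_less_one] .
    obtain n where "c ^ n < r / R"
      using real_arch_pow_inv[of "r / R" c] r R c by auto
    then have "R \<le> r / c ^ n"
      using R(1) c(1) by (simp add: field_simps)
    then have "measure \<mu> (ball x R) \<le> measure \<mu> (ball x (r / c ^ n))"
      by (intro finite_measure_mono subset_ball) (simp_all add: sets)
    with R(2) have "0 < measure \<mu> (ball x (r / c ^ n))" by simp
    then show "0 < measure \<mu> (ball x r)" by (rule iterate)
  qed
qed

section \<open>Support points are limits of fixed points\<close>

text \<open>
  The preimages along words with many occurrences of \<open>j\<close> carry, in the supremum, at least
  the mass of \<open>E\<close>. Let \<open>s\<^sub>m\<close> be the supremum of the masses of \<open>F\<^sub>v\<^sup>-\<^sup>1(E)\<close> over the words \<open>v\<close> with at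
  least \<open>m\<close> occurrences of \<open>j\<close>. Splitting the mass of \<open>F\<^sub>v\<^sup>-\<^sup>1(E)\<close> over the letter appended to
  \<open>v\<close> gives \<open>s\<^sub>m \<le> \<rho>\<^sub>j s\<^sub>m\<^sub>+\<^sub>1 + (1 - \<rho>\<^sub>j) s\<^sub>m\<close>, and \<open>\<rho>\<^sub>j > 0\<close> turns this into \<open>s\<^sub>m \<le> s\<^sub>m\<^sub>+\<^sub>1\<close>. Since
  \<open>s\<^sub>0\<close> is at least the mass of \<open>E\<close>, so is every \<open>s\<^sub>m\<close>.
\<close>

lemma ex_word_frequent_letter:
  fixes F :: "nat \<Rightarrow> 'a::metric_space \<Rightarrow> 'a"
  assumes F: "\<And>i. contraction (F i)"
    and \<rho>: "probability_sequence \<rho>"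
    and \<mu>: "invariant_measure F \<rho> \<mu>"
    and E: "E \<in> sets borel" and a: "a < measure \<mu> E"
  shows "\<exists>v. k \<le> count_list v j \<and> a < measure \<mu> (compose_word F v -` E)"
proof -
  interpret prob_space \<mu>
    using \<mu> by (simp add: invariant_measure_def)
  define M where "M v = measure \<mu> (compose_word F v -` E)" for v
  define s where "s m = (SUP v\<in>{v. m \<le> count_list v j}. M v)" for m
  have nonempty: "{v. m \<le> count_list v j} \<noteq> {}" for m
  proof -
    have "count_list (replicate m j) j = m" by (induction m) auto
    then have "replicate m j \<in> {v. m \<le> count_list v j}" by simp
    then show ?thesis by blast
  qed
  have bdd: "bdd_above (M ` {v. m \<le> count_list v j})" for m
    by (rule bdd_aboveI2[where M = 1]) (simp add: M_def)
  have M_le: "M v \<le> s m" if "m \<le> count_list v j" for v m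
    unfolding s_def using that by (intro cSUP_upper bdd) simp
  have s_least: "s m \<le> b" if "\<And>v. m \<le> count_list v j \<Longrightarrow> M v \<le> b" for m b
    unfolding s_def using that by (intro cSUP_least nonempty) simp
  have \<rho>_pos: "0 < \<rho> i" for i
    using \<rho> by (simp add: probability_sequence_def)
  have \<rho>_sums: "\<rho> sums 1"
    using \<rho> by (simp add: probability_sequence_def)
  have step: "s m \<le> s (Suc m)" for m
  proof -
    have "M v \<le> s m - \<rho> j * (s m - s (Suc m))" if v: "m \<le> count_list v j" for v
    proof -
      have vi: "F i -` (compose_word F v -` E) = compose_word F (v @ [i]) -` E" for i
        by (simp add: compose_word_append vimage_comp)
      have M_sums: "(\<lambda>i. \<rho> i * M (v @ [i])) sums M v"
        using \<mu> borel_vimage_compose_word[OF F E, where w = v]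
        by (simp add: invariant_measure_def M_def flip: vi)
      have "(\<lambda>i. if i = j then \<rho> i * (s m - s (Suc m)) else 0) sums (\<rho> j * (s m - s (Suc m)))"
        by (rule sums_single)
      from sums_diff[OF sums_mult2[OF \<rho>_sums, of "s m"] this]
      have bound_sums: "(\<lambda>i. \<rho> i * s m - (if i = j then \<rho> i * (s m - s (Suc m)) else 0)) sums
          (s m - \<rho> j * (s m - s (Suc m)))"
        by simp
      have "\<rho> i * M (v @ [i]) \<le> \<rho> i * s m - (if i = j then \<rho> i * (s m - s (Suc m)) else 0)" for i
      proof (cases "i = j")
        case True
        then have "M (v @ [i]) \<le> s (Suc m)"
          using v by (intro M_le) simp
        then have "\<rho> i * M (v @ [i]) \<le> \<rho> i * s (Suc m)"
          using \<rho>_pos[of i] by simp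
        then show ?thesis
          using True by (simp add: algebra_simps)
      next
        case False
        have "M (v @ [i]) \<le> s m"
          using v by (intro M_le) simp
        then show ?thesis
          using False \<rho>_pos[of i] by simp
      qed
      from sums_le[OF this M_sums bound_sums] show ?thesis .
    qed
    then have "s m \<le> s m - \<rho> j * (s m - s (Suc m))"
      by (rule s_least)
    then have "\<rho> j * (s m - s (Suc m)) \<le> 0" by simp
    then show ?thesis
      using \<rho>_pos[of j] by (simp add: mult_le_0_iff)
  qed
  have "measure \<mu> E \<le> s 0"
    using M_le[of 0 "[]"] by (simp add: M_def)
  also have "s 0 \<le> s k"
    using step by (rule lift_Suc_mono_le) simp
  finally have "a < (SUP v\<in>{v. k \<le> count_list v j}. M v)"
    using a unfolding s_def by simp
  then show ?thesis
    using less_cSUP_iff[OF nonempty bdd] by (auto simp: M_def)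
qed

lemma measure_support_subset_closure_fixed_points:
  fixes F :: "nat \<Rightarrow> 'a::complete_space \<Rightarrow> 'a"
  assumes F: "\<And>i. contraction (F i)"
    and \<rho>: "probability_sequence \<rho>"
    and \<mu>: "invariant_measure F \<rho> \<mu>"
  shows "measure_support \<mu> \<subseteq> closure (fixed_points_of_compositions F)"
proof
  interpret prob_space \<mu>
    using \<mu> by (simp add: invariant_measure_def)
  have sets: "sets \<mu> = sets borel"
    using \<mu> by (simp add: invariant_measure_def)
  fix x
  assume x: "x \<in> measure_support \<mu>"
  show "x \<in> closure (fixed_points_of_compositions F)"
    unfolding closure_approachable
  proof (intro allI impI)
    fix e :: real
    assume e: "0 < e"
    define E where "E = ball x (e / 2)"
    have E: "E \<in> sets borel" "0 < measure \<mu> E"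
      using x e by (auto simp: E_def measure_support_def)
    obtain R where R: "0 < R" "1 - measure \<mu> E < measure \<mu> (ball x R)"
      using ex_ball_measure_gt[OF prob_space_axioms sets, of "1 - measure \<mu> E"] E(2) by auto
    obtain c where c: "0 < c" "c < 1" "c-lipschitz_on UNIV (F 0)"
      using contraction_ratio[OF F] .
    (* The fixed point found below lies within C * (R + e / 2) / (1 - C) of E. *)
    obtain n where n: "c ^ n < (1 - c) * (e / 2) / (R + e / 2)"
      using real_arch_pow_inv[of "(1 - c) * (e / 2) / (R + e / 2)" c] c e R by auto
    obtain v where v: "Suc n \<le> count_list v 0"
      "1 - measure \<mu> (ball x R) < measure \<mu> (compose_word F v -` E)"
      using ex_word_frequent_letter[OF F \<rho> \<mu> E(1), of "1 - measure \<mu> (ball x R)" "Suc n" 0] R(2)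
      by auto
    have meas: "compose_word F v -` E \<in> sets \<mu>"
      using borel_vimage_compose_word[OF F E(1)] sets by simp
    have "compose_word F v -` E \<inter> ball x R \<noteq> {}"
    proof
      assume "compose_word F v -` E \<inter> ball x R = {}"
      then have "measure \<mu> (compose_word F v -` E \<union> ball x R)
          = measure \<mu> (compose_word F v -` E) + measure \<mu> (ball x R)"
        using meas by (intro finite_measure_Union) (auto simp: sets)
      then show False
        using v(2) prob_le_1[of "compose_word F v -` E \<union> ball x R"] by linarith
    qed
    then obtain y where y: "dist x y < R" "dist x (compose_word F v y) < e / 2"
      by (auto simp: E_def)
    define C where "C = c ^ count_list v 0"
    have "C \<le> c ^ Suc n"
      unfolding C_def using v(1) c by (intro power_decreasing) auto
    moreover have "c ^ Suc n \<le> c ^ n" "c ^ Suc n \<le> c ^ 1"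
      using c power_decreasing[of n "Suc n" c] power_decreasing[of 1 "Suc n" c]
      by (simp_all del: power_Suc)
    ultimately have C: "0 < C" "C \<le> c ^ n" "C \<le> c"
      unfolding C_def using c(1) by (auto simp del: power_Suc)
    have lip: "C-lipschitz_on UNIV (compose_word F v)"
      unfolding C_def by (intro compose_word_lipschitz contraction_nonexpansive F c(3))
    then obtain p where p: "compose_word F v p = p"
      "(1 - C) * dist p y \<le> dist (compose_word F v y) y"
      using fixed_point_near_almost_fixed_point[of C "compose_word F v" y] C(3) c(2) by auto
    have "(1 - c) * dist p y \<le> (1 - C) * dist p y"
      using C(3) by (intro mult_right_mono) auto
    also have "\<dots> \<le> dist (compose_word F v y) y"
      by (fact p(2))
    also have "\<dots> \<le> R + e / 2"
      using dist_triangle[of "compose_word F v y" y x] y by (simp add: dist_commute)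
    finally have "C * ((1 - c) * dist p y) \<le> c ^ n * (R + e / 2)"
      using C c by (intro mult_mono) auto
    also have "\<dots> < (1 - c) * (e / 2)"
      using n R(1) e by (subst (asm) pos_less_divide_eq) auto
    finally have "(1 - c) * (C * dist p y) < (1 - c) * (e / 2)"
      by (simp add: mult.left_commute)
    then have "C * dist p y < e / 2"
      using c(2) by simp
    then have "dist p (compose_word F v y) < e / 2"
      using lipschitz_onD[OF lip, of p y] p(1) by simp
    then have "dist p x < e"
      using dist_triangle[of p x "compose_word F v y"] y(2) by (simp add: dist_commute)
    moreover have "p \<in> fixed_points_of_compositions F"
      using p(1) v(1) by (auto simp: fixed_points_of_compositions_def intro!: exI[of _ v])
    ultimately show "\<exists>p\<in>fixed_points_of_compositions F. dist p x < e" by blast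
  qed
qed

section \<open>The support as the closure of the fixed points\<close>

theorem theorem3p6:
  fixes F :: "nat \<Rightarrow> 'a::complete_space \<Rightarrow> 'a"
    and \<rho> :: "nat \<Rightarrow> real"
    and \<mu> :: "'a measure"
  assumes "\<And>i. contraction (F i)"
    and "probability_sequence \<rho>"
    and "invariant_measure F \<rho> \<mu>"
  shows "measure_support \<mu> = closure (fixed_points_of_compositions F)"
proof
  show "measure_support \<mu> \<subseteq> closure (fixed_points_of_compositions F)"
    by (rule measure_support_subset_closure_fixed_points[OF assms])
  have "prob_space \<mu>" and "sets \<mu> = sets borel"
    using assms(3) by (auto simp: invariant_measure_def)
  then have "closed (measure_support \<mu>)"
    by (intro closed_measure_support prob_space.finite_measure)
  then show "closure (fixed_points_of_compositions F) \<subseteq> measure_support \<mu>"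
    by (intro closure_minimal fixed_points_subset_measure_support[OF assms])
qed

end
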